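(* Let $q$ be a prime power, $f\in\mathcal{LP}_q$ and $g_1,g_2\in\mathcal{P}_q$. Then $\odot_f(g_1,g_2)\in\mathcal{P}_q$ if and only if the subset $$\{(g_1(a),\,g_2(a),\,\odot_f(g_1,g_2)(a))\colon a\in\mathbb{F}_q\}\subset\mathrm{Ent}(L_f)$$ is a transversal of $L_f$.
   Context: $\mathbb{F}_q$ is the finite field with $q$ elements. $\mathcal{P}_q$ is the set of polynomials in $\mathbb{F}_q[x]$ of degree less than $q$ that act as permutations of $\mathbb{F}_q$. $\mathcal{LP}_q$ is the set of polynomials $f\in\mathbb{F}_q[x,y]$ of degree less than $q$ in each variable such that, for every $a\in\mathbb{F}_q$, both $f(x,a)$ and $f(a,x)$ act as permutations of $\mathbb{F}_q$. For $f\in\mathcal{LP}_q$ and $g_1,g_2\in\mathcal{P}_q$, put $\odot_f(g_1,g_2):=f(g_1(x),g_2(x))\in\mathbb{F}_q[x]$, taken modulo $x^q-x$. $L_f$ is the Latin square with rows, columns and symbols indexed by $\mathbb{F}_q$ given by $L_f[a,b]:=f(a,b)$, and $\mathrm{Ent}(L_f):=\{(a,b,L_f[a,b])\colon a,b\in\mathbb{F}_q\}$. A transversal of $L_f$ is a subset of $\mathrm{Ent}(L_f)$ formed by $q$ entries, no two of which lie in the same row, lie in the same column, or contain the same symbol. *)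

theory Defs
  imports "HOL-Computational_Algebra.Polynomial" "HOL-Library.Cardinality"
begin

text \<open>
  The finite field with \<open>q\<close> elements is a type \<open>'a :: {field, finite}\<close>, with \<open>q = CARD('a)\<close>.
  A bivariate polynomial \<open>f(x,y)\<close> is an element of \<open>'a poly poly\<close>, read as a polynomial in \<open>y\<close>
  whose coefficients are polynomials in \<open>x\<close>.
\<close>

definition perm_polys :: "'a::{field, finite} poly set" where
  "perm_polys = {g. degree g < CARD('a) \<and> bij (poly g)}"

text \<open>\<open>f(g(x), h(x))\<close>, without any reduction.\<close>

definition subst2 :: "'a::comm_ring_1 poly poly \<Rightarrow> 'a poly \<Rightarrow> 'a poly \<Rightarrow> 'a poly" where
  "subst2 f g h = poly (map_poly (\<lambda>c. pcompose c g) f) h"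

definition eval2 :: "'a::comm_ring_1 poly poly \<Rightarrow> 'a \<Rightarrow> 'a \<Rightarrow> 'a" where
  "eval2 f a b = poly (poly f [:b:]) a"

text \<open>The first two conditions bound the degree in \<open>y\<close> and in \<open>x\<close>; \<open>[:0, 1:]\<close> is the variable.\<close>

definition local_perm_polys :: "'a::{field, finite} poly poly set" where
  "local_perm_polys = {f. degree f < CARD('a) \<and> (\<forall>i. degree (coeff f i) < CARD('a)) \<and>
     (\<forall>a. bij (poly (subst2 f [:0, 1:] [:a:])) \<and> bij (poly (subst2 f [:a:] [:0, 1:])))}"

definition odot ::
    "'a::{field, finite} poly poly \<Rightarrow> 'a poly \<Rightarrow> 'a poly \<Rightarrow> 'a poly" where
  "odot f g1 g2 = subst2 f g1 g2 mod (monom 1 CARD('a) - [:0, 1:])"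

text \<open>A square array is given by the function sending a row and a column to a symbol.\<close>

definition latin_square :: "('a::finite \<Rightarrow> 'a \<Rightarrow> 'a) \<Rightarrow> bool" where
  "latin_square L \<longleftrightarrow> (\<forall>a. bij (\<lambda>b. L a b)) \<and> (\<forall>b. bij (\<lambda>a. L a b))"

definition Lsq :: "'a::{field, finite} poly poly \<Rightarrow> 'a \<Rightarrow> 'a \<Rightarrow> 'a" where
  "Lsq f a b = eval2 f a b"

definition Ent :: "('a::finite \<Rightarrow> 'a \<Rightarrow> 'a) \<Rightarrow> ('a \<times> 'a \<times> 'a) set" where
  "Ent L = {(a, b, L a b) | a b. True}"

definition transversal :: "('a::finite \<Rightarrow> 'a \<Rightarrow> 'a) \<Rightarrow> ('a \<times> 'a \<times> 'a) set \<Rightarrow> bool" where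
  "transversal L T \<longleftrightarrow> T \<subseteq> Ent L \<and> card T = CARD('a) \<and>
     (\<forall>(r, c, s) \<in> T. \<forall>(r', c', s') \<in> T.
        (r, c, s) \<noteq> (r', c', s') \<longrightarrow> r \<noteq> r' \<and> c \<noteq> c' \<and> s \<noteq> s')"

lemma poly_subst2: "poly (subst2 f g h) a = eval2 f (poly g a) (poly h a)"
proof -
  have "poly (subst2 f g h) a = poly (poly (map_poly (\<lambda>c. pcompose c g) f) h) a"
    by (simp add: subst2_def)
  also have "\<dots> = poly (poly f [:poly h a:]) (poly g a)"
    by (induction f) (auto simp: map_poly_pCons poly_pcompose)
  finally show ?thesis by (simp add: eval2_def)
qed

lemma latin_square_Lsq:
  assumes "f \<in> local_perm_polys"
  shows "latin_square (Lsq f)"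
  using assms
  by (auto simp: latin_square_def Lsq_def local_perm_polys_def poly_subst2[abs_def])

end

theory Submission
  imports Defs
begin

text \<open>
  Since \<open>x ^ q = x\<close> on the field, reducing modulo \<open>x ^ q - x\<close> does not change values, so
  \<open>odot f g1 g2\<close> evaluates to \<open>f(g1(a), g2(a))\<close>. The triples therefore lie in the Latin square,
  and injectivity of \<open>g1\<close> and \<open>g2\<close> makes the rows and columns distinct. The only remaining
  condition is that the symbols be distinct, i.e. that \<open>odot f g1 g2\<close> be injective on the field.
\<close>

text \<open>Multiplication by a nonzero \<open>a\<close> permutes the nonzero elements, so their
  product is unchanged when each factor is scaled by \<open>a\<close>; cancelling it leaves
  \<open>a ^ (CARD('a) - 1) = 1\<close>.\<close>

lemma power_CARD_eq_self: "a ^ CARD('a) = a" for a :: "'a::{field, finite}"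
proof (cases "a = 0")
  case False
  let ?N = "UNIV - {0 :: 'a}"
  have "bij_betw ((*) a) ?N ?N"
    by (rule bij_betw_byWitness[where f' = "\<lambda>x. x / a"]) (use False in auto)
  then have "(\<Prod>x\<in>?N. a * x) = \<Prod>?N"
    by (rule prod.reindex_bij_betw)
  then have "a ^ card ?N * \<Prod>?N = \<Prod>?N"
    by (simp add: prod.distrib)
  moreover have "\<Prod>?N \<noteq> 0"
    by simp
  ultimately have "a ^ card ?N = 1"
    by simp
  moreover have "CARD('a) = Suc (card ?N)"
    by (metis UNIV_I card.remove finite)
  ultimately show ?thesis
    by (metis mult.right_neutral power_Suc)
qed simp

lemma CARD_field_ge_2: "CARD('a::{field, finite}) \<ge> 2"
proof -
  have "card {0, 1 :: 'a} \<le> CARD('a)"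
    by (rule card_mono) auto
  then show ?thesis by simp
qed

lemma degree_monom_CARD_minus_X:
  "degree (monom 1 CARD('a) - [:0, 1:] :: 'a::{field, finite} poly) = CARD('a)"
  \<comment> \<open>The bound makes the monomial dominate the subtracted term of degree 1.\<close>
  using CARD_field_ge_2[where 'a = 'a]
  by (subst diff_conv_add_uminus, subst degree_add_eq_left) (auto simp: degree_monom_eq)

lemma degree_odot_less: "degree (odot f g h) < CARD('a)"
  for f :: "'a::{field, finite} poly poly"
proof -
  let ?m = "monom 1 CARD('a) - [:0, 1:] :: 'a poly"
  \<comment> \<open>A zero remainder has degree 0, so the strict bound needs a modulus of positive
    degree.\<close>
  have "degree ?m > 0"
    unfolding degree_monom_CARD_minus_X by simp
  then have "degree (subst2 f g h mod ?m) < degree ?m"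
    by (cases "subst2 f g h mod ?m = 0") (auto intro: degree_mod_less')
  then show ?thesis
    unfolding odot_def degree_monom_CARD_minus_X .
qed

lemma poly_odot: "poly (odot f g h) a = Lsq f (poly g a) (poly h a)"
proof -
  let ?m = "monom 1 CARD('a) - [:0, 1:] :: 'a poly"
  have "poly (subst2 f g h) a
      = poly (subst2 f g h div ?m) a * poly ?m a + poly (odot f g h) a"
    unfolding odot_def by (metis div_mult_mod_eq poly_add poly_mult)
  also have "poly ?m a = 0"
    by (simp add: poly_monom power_CARD_eq_self)
  finally show ?thesis
    by (simp add: poly_subst2 Lsq_def)
qed

text \<open>The reduction supplies the degree bound, and an injective self-map of a finite set is
  onto.\<close>

lemma odot_mem_perm_polys_iff: "odot f g h \<in> perm_polys \<longleftrightarrow> inj (poly (odot f g h))"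
proof -
  have "bij (poly (odot f g h)) \<longleftrightarrow> inj (poly (odot f g h))"
    using finite_UNIV_inj_surj[OF finite] unfolding bij_def by blast
  then show ?thesis
    by (simp add: perm_polys_def degree_odot_less)
qed

lemma transversal_range_iff:
  fixes L :: "'a::finite \<Rightarrow> 'a \<Rightarrow> 'a" and r c :: "'a \<Rightarrow> 'a"
  assumes "inj r" and "inj c"
  shows "transversal L (range (\<lambda>a. (r a, c a, L (r a) (c a)))) \<longleftrightarrow> inj (\<lambda>a. L (r a) (c a))"
proof -
  let ?e = "\<lambda>a. (r a, c a, L (r a) (c a))"
  \<comment> \<open>The first coordinates already separate the triples, which gives the cardinality
    required of a transversal.\<close>
  have "inj ?e"
    by (rule injI) (use assms in \<open>auto dest: injD\<close>)
  then have "card (range ?e) = CARD('a)"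
    by (rule card_image)
  moreover have "range ?e \<subseteq> Ent L"
    by (auto simp: Ent_def)
  ultimately have "transversal L (range ?e) \<longleftrightarrow>
      (\<forall>a b. ?e a \<noteq> ?e b \<longrightarrow> r a \<noteq> r b \<and> c a \<noteq> c b \<and> L (r a) (c a) \<noteq> L (r b) (c b))"
    by (simp add: transversal_def)
  \<comment> \<open>Distinct triples now mean distinct indices, for which rows and columns differ
    automatically.\<close>
  also have "\<dots> \<longleftrightarrow> (\<forall>a b. a \<noteq> b \<longrightarrow> L (r a) (c a) \<noteq> L (r b) (c b))"
    unfolding inj_eq[OF \<open>inj ?e\<close>] by (simp add: inj_eq[OF assms(1)] inj_eq[OF assms(2)])
  also have "\<dots> \<longleftrightarrow> inj (\<lambda>a. L (r a) (c a))"
    unfolding inj_def by blast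
  finally show ?thesis .
qed

theorem lemma5p2:
  fixes f :: "'a::{field, finite} poly poly" and g1 g2 :: "'a poly"
  assumes "f \<in> local_perm_polys"
    and "g1 \<in> perm_polys"
    and "g2 \<in> perm_polys"
  shows "{(poly g1 a, poly g2 a, poly (odot f g1 g2) a) | a. True} \<subseteq> Ent (Lsq f) \<and>
    (odot f g1 g2 \<in> perm_polys \<longleftrightarrow>
      transversal (Lsq f) {(poly g1 a, poly g2 a, poly (odot f g1 g2) a) | a. True})"
proof
  show "{(poly g1 a, poly g2 a, poly (odot f g1 g2) a) | a. True} \<subseteq> Ent (Lsq f)"
    by (auto simp: Ent_def poly_odot)
  have "inj (poly g1)" "inj (poly g2)"
    using assms(2,3) by (auto simp: perm_polys_def bij_is_inj)
  \<comment> \<open>By \<open>poly_odot\<close> the third coordinate is the symbol of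
    \<open>Lsq f\<close> at the first two, so the set is a range as in
    \<open>transversal_range_iff\<close>.\<close>
  then show "odot f g1 g2 \<in> perm_polys \<longleftrightarrow>
      transversal (Lsq f) {(poly g1 a, poly g2 a, poly (odot f g1 g2) a) | a. True}"
    using transversal_range_iff[of "poly g1" "poly g2" "Lsq f"]
    by (simp add: odot_mem_perm_polys_iff poly_odot[abs_def] full_SetCompr_eq)
qed

end
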